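(* Let $N=\{1,\ldots,n\}$ and let a bisubmodular function $h:3^N\to\mathbb{R}$ and vectors $a \in \mathbb{R}^n_{>0}$ and $b \in \mathbb{R}^n$ be given. Then the following hold: (i) any least $(a,b)$-majorized element of the base polyhedron $B(h_{(N,\emptyset)})$ is also a least weakly $(a,b)$-supermajorized element of $\tilde{B}(h)$; (ii) any least $(a,b)$-majorized element of the base polyhedron $B_{\text{sup}}(-h_{(\emptyset,N)})$ is also a least weakly $(a,b)$-submajorized element of $\tilde{B}(h)$. Moreover, if $h$ and $b$ are integral, then also the following hold: (iii) any least $(1,b)$-majorized element of the integral base polyhedron $B^{\mathbb{Z}}(h_{(N,\emptyset)})$ is also a least weakly $(1,b)$-supermajorized element of $\tilde{B}^{\mathbb{Z}}(h)$; (iv) any least $(1,b)$-majorized element of the integral base polyhedron $B^{\mathbb{Z}}_{\text{sup}}(-h_{(\emptyset,N)})$ is also a least weakly $(1,b)$-submajorized element of $\tilde{B}^{\mathbb{Z}}(h)$.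
   Context: Notation: $x(A) := \sum_{i\in A} x_i$ for $x\in\mathbb{R}^n$, $A\subseteq N$; in "$(1,b)$", $1$ is the all-ones vector; "integral" means integer-valued. $3^N$ is the set of ordered pairs $(S,T)$ of disjoint subsets of $N$. $h:3^N\to\mathbb{R}$ with $h(\emptyset,\emptyset)=0$ is bisubmodular if for all $(S_1,T_1),(S_2,T_2)\in 3^N$, $h(S_1,T_1)+h(S_2,T_2)\ge h\big((S_1\cup S_2)\setminus(T_1\cup T_2),(T_1\cup T_2)\setminus(S_1\cup S_2)\big)+h(S_1\cap S_2,T_1\cap T_2)$. $\tilde B(h):=\{x\in\mathbb{R}^n: x(S)-x(T)\le h(S,T)\ \forall (S,T)\in 3^N\}$ and $\tilde B^{\mathbb{Z}}(h):=\tilde B(h)\cap\mathbb{Z}^n$. For $(S,T)\in3^N$, $h_{(S,T)}$ is the (submodular) set function $h_{(S,T)}(X):=h(S\cap X,T\cap X)$, $X\subseteq N$; so $h_{(N,\emptyset)}(X)=h(X,\emptyset)$ and $h_{(\emptyset,N)}(X)=h(\emptyset,X)$. For a submodular set function $f$: $B(f):=\{x\in\mathbb{R}^n: x(A)\le f(A)\ \forall A\subseteq N,\ x(N)=f(N)\}$; for a supermodular set function $g$: $B_{\text{sup}}(g):=\{x\in\mathbb{R}^n: x(A)\ge g(A)\ \forall A\subseteq N,\ x(N)=g(N)\}$. $B^{\mathbb{Z}}(f)$ and $B^{\mathbb{Z}}_{\text{sup}}(g)$ are their intersections with $\mathbb{Z}^n$. Majorization: for $a\in\mathbb{R}^n_{>0}$,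 $b\in\mathbb{R}^n$ and $x,y\in\mathbb{R}^n$, consider the inequality $\sum_{i\in N} a_i\phi\left(\frac{x_i+b_i}{a_i}\right)\le \sum_{i\in N} a_i\phi\left(\frac{y_i+b_i}{a_i}\right)$ ( * ). Then $x$ is $(a,b)$-majorized by $y$ if $x(N)=y(N)$ and ( * ) holds for all continuous convex $\phi:\mathbb{R}\to\mathbb{R}$; weakly $(a,b)$-submajorized (resp. weakly $(a,b)$-supermajorized) by $y$ if ( * ) holds for all non-decreasing (resp. non-increasing) continuous convex $\phi$. For $C\subseteq\mathbb{R}^n$, $x\in C$ is a least $(a,b)$-majorized (resp. least weakly $(a,b)$-submajorized, least weakly $(a,b)$-supermajorized) element of $C$ if it is so majorized by every $y\in C$. *)

theory Defs
  imports "HOL-Analysis.Analysis"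
begin

text \<open>The ground set \<open>N = {1, \<dots>, n}\<close> is the universe of a finite index type \<open>'n\<close>.\<close>

text \<open>The set \<open>3\<^sup>N\<close> of ordered pairs of disjoint subsets. Functions on it are represented by total
  functions on all pairs; their values at non-disjoint pairs are irrelevant.\<close>

definition disjoint_pairs :: "('n set \<times> 'n set) set" where
  "disjoint_pairs = {(S, T). S \<inter> T = {}}"

definition bisubmodular :: "('n set \<times> 'n set \<Rightarrow> real) \<Rightarrow> bool" where
  "bisubmodular h \<longleftrightarrow>
     h ({}, {}) = 0 \<and>
     (\<forall>(S1, T1) \<in> disjoint_pairs. \<forall>(S2, T2) \<in> disjoint_pairs.
        h (S1, T1) + h (S2, T2) \<ge>
          h ((S1 \<union> S2) - (T1 \<union> T2), (T1 \<union> T2) - (S1 \<union> S2)) + h (S1 \<inter> S2, T1 \<inter> T2))"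

definition vec_sum :: "real ^ 'n \<Rightarrow> 'n set \<Rightarrow> real" where
  "vec_sum x A = (\<Sum>i\<in>A. x $ i)"

definition integral_vectors :: "(real ^ 'n) set" where
  "integral_vectors = {x. \<forall>i. x $ i \<in> \<int>}"

definition bisub_polyhedron :: "('n set \<times> 'n set \<Rightarrow> real) \<Rightarrow> (real ^ 'n) set" where
  "bisub_polyhedron h = {x. \<forall>(S, T) \<in> disjoint_pairs. vec_sum x S - vec_sum x T \<le> h (S, T)}"

text \<open>The set function \<open>h\<^bsub>(S,T)\<^esub>\<close>.\<close>

definition orthant_fun :: "('n set \<times> 'n set \<Rightarrow> real) \<Rightarrow> 'n set \<times> 'n set \<Rightarrow> 'n set \<Rightarrow> real" where
  "orthant_fun h = (\<lambda>(S, T) X. h (S \<inter> X, T \<inter> X))"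

definition base_polyhedron :: "('n set \<Rightarrow> real) \<Rightarrow> (real ^ 'n) set" where
  "base_polyhedron f = {x. (\<forall>A. vec_sum x A \<le> f A) \<and> vec_sum x UNIV = f UNIV}"

definition base_polyhedron_sup :: "('n set \<Rightarrow> real) \<Rightarrow> (real ^ 'n) set" where
  "base_polyhedron_sup g = {x. (\<forall>A. vec_sum x A \<ge> g A) \<and> vec_sum x UNIV = g UNIV}"

definition phi_le :: "real ^ 'n \<Rightarrow> real ^ 'n \<Rightarrow> (real \<Rightarrow> real) \<Rightarrow> real ^ 'n \<Rightarrow> real ^ 'n \<Rightarrow> bool" where
  "phi_le a b \<phi> x y \<longleftrightarrow>
     (\<Sum>i\<in>UNIV. a $ i * \<phi> ((x $ i + b $ i) / a $ i)) \<le>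
     (\<Sum>i\<in>UNIV. a $ i * \<phi> ((y $ i + b $ i) / a $ i))"

text \<open>In the following relations the first vector is the one that is (weakly) majorized by the
  second. They are meant for \<open>a\<close> with positive components.\<close>

definition majorized :: "real ^ 'n \<Rightarrow> real ^ 'n \<Rightarrow> real ^ 'n \<Rightarrow> real ^ 'n \<Rightarrow> bool" where
  "majorized a b x y \<longleftrightarrow>
     vec_sum x UNIV = vec_sum y UNIV \<and>
     (\<forall>\<phi>. continuous_on UNIV \<phi> \<and> convex_on UNIV \<phi> \<longrightarrow> phi_le a b \<phi> x y)"

definition weakly_submajorized :: "real ^ 'n \<Rightarrow> real ^ 'n \<Rightarrow> real ^ 'n \<Rightarrow> real ^ 'n \<Rightarrow> bool" where
  "weakly_submajorized a b x y \<longleftrightarrow>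
     (\<forall>\<phi>. mono \<phi> \<and> continuous_on UNIV \<phi> \<and> convex_on UNIV \<phi> \<longrightarrow> phi_le a b \<phi> x y)"

definition weakly_supermajorized :: "real ^ 'n \<Rightarrow> real ^ 'n \<Rightarrow> real ^ 'n \<Rightarrow> real ^ 'n \<Rightarrow> bool" where
  "weakly_supermajorized a b x y \<longleftrightarrow>
     (\<forall>\<phi>. antimono \<phi> \<and> continuous_on UNIV \<phi> \<and> convex_on UNIV \<phi> \<longrightarrow> phi_le a b \<phi> x y)"

definition least_element :: "('v \<Rightarrow> 'v \<Rightarrow> bool) \<Rightarrow> 'v set \<Rightarrow> 'v \<Rightarrow> bool" where
  "least_element R C x \<longleftrightarrow> x \<in> C \<and> (\<forall>y\<in>C. R x y)"

end

theory Submission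
  imports Defs
begin

text \<open>Let \<open>f = h(\<cdot>, {})\<close>. Bisubmodularity for \<open>(S, T)\<close> and \<open>(N, {})\<close> gives \<open>B(f) \<subseteq> B\<^sup>~(h)\<close>. Every
  \<open>y\<close> in \<open>B\<^sup>~(h)\<close> satisfies \<open>y(A) \<le> f(A)\<close> for all \<open>A\<close> and can therefore be raised, one coordinate at a
  time, to some \<open>z \<ge> y\<close> in \<open>B(f)\<close>; a least majorized \<open>x\<close> of \<open>B(f)\<close> is majorized by \<open>z\<close>, and a
  non-increasing \<open>\<phi>\<close> has values at \<open>z\<close> that are at most those at \<open>y\<close>. The increments
  are differences of values of \<open>f\<close> and \<open>y\<close>, so the real and the integral case are both
  instances of coordinates taken from an additive subgroup \<open>G\<close> of the reals. The statements
  about \<open>B\<^sub>s\<^sub>u\<^sub>p\<close> follow by negating all vectors and exchanging the two arguments of \<open>h\<close>.\<close>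

section \<open>Tight sets and raising a vector into a base polyhedron\<close>

lemma vec_sum_add_axis:
  "vec_sum (x + axis i c) A = vec_sum x A + (if i \<in> A then c else 0)"
proof -
  have "(\<Sum>j\<in>A. axis i c $ j) = (\<Sum>j\<in>A. if j = i then c else 0)"
    by (rule sum.cong) (auto simp: axis_def)
  then show ?thesis
    by (simp add: vec_sum_def sum.distrib)
qed

lemma vec_sum_Un_Int:
  "vec_sum x (A \<union> B) + vec_sum x (A \<inter> B) = vec_sum x A + vec_sum x B"
  unfolding vec_sum_def by (rule sum.union_inter) auto

lemma vec_sum_uminus: "vec_sum (- x) A = - vec_sum x A"
  by (simp add: vec_sum_def sum_negf)

text \<open>Since \<open>vec_sum z\<close> is modular, tightness of \<open>A\<close> and
  \<open>B\<close> forces equality in the submodular inequality, and then in both bounds for the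
  union and the intersection.\<close>

lemma submodular_tight_Un:
  fixes f :: "'n::finite set \<Rightarrow> real"
  assumes sub: "\<And>A B. f (A \<union> B) + f (A \<inter> B) \<le> f A + f B"
    and le: "\<And>A. vec_sum z A \<le> f A"
    and "vec_sum z A = f A" "vec_sum z B = f B"
  shows "vec_sum z (A \<union> B) = f (A \<union> B)"
  using sub[of A B] le[of "A \<union> B"] le[of "A \<inter> B"] vec_sum_Un_Int[of z A B] assms(3,4)
  by linarith

lemma raise_into_base_polyhedron:
  fixes f :: "'n::finite set \<Rightarrow> real" and y :: "real ^ 'n"
  assumes sub: "\<And>A B. f (A \<union> B) + f (A \<inter> B) \<le> f A + f B"
    and f0: "f {} = 0"
    and y: "\<And>A. vec_sum y A \<le> f A"
    and G0: "0 \<in> G" and Gd: "\<And>u v. u \<in> G \<Longrightarrow> v \<in> G \<Longrightarrow> u - v \<in> G"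
    and fG: "\<And>A. f A \<in> G" and yG: "\<And>i. y $ i \<in> G"
  obtains z where "z \<in> base_polyhedron f" "\<And>i. y $ i \<le> z $ i" "\<And>i. z $ i \<in> G"
proof -
  have Ga: "u + v \<in> G" if "u \<in> G" "v \<in> G" for u v
    using Gd[OF that(1) Gd[OF G0 that(2)]] by simp
  have sumG: "vec_sum z A \<in> G" if "\<forall>i. z $ i \<in> G" for z :: "real ^ 'n" and A
  proof -
    have "finite A" by simp
    then show ?thesis
      unfolding vec_sum_def
      by (induction A rule: finite_induct) (use that in \<open>auto intro: G0 Ga\<close>)
  qed
  \<comment> \<open>Invariant after the coordinates in \<open>I\<close> have been treated: one tight
    set \<open>T\<close> covers them all. It may exceed \<open>I\<close>, but for
    \<open>I = UNIV\<close> it must be \<open>UNIV\<close>, which is the equation required of a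
    base.\<close>
  have "\<exists>z T. (\<forall>A. vec_sum z A \<le> f A) \<and> (\<forall>i. y $ i \<le> z $ i) \<and> (\<forall>i. z $ i \<in> G) \<and>
      I \<subseteq> T \<and> vec_sum z T = f T" if "finite I" for I :: "'n set"
    using that
  proof (induction I rule: finite_induct)
    case empty
    show ?case
      using y yG f0 by (intro exI[of _ y] exI[of _ "{}"]) (auto simp: vec_sum_def)
  next
    case (insert i I)
    then obtain z T where z: "\<And>A. vec_sum z A \<le> f A" "\<And>j. y $ j \<le> z $ j" "\<forall>j. z $ j \<in> G"
      and T: "I \<subseteq> T" "vec_sum z T = f T" by blast
    \<comment> \<open>The least slack of a set containing \<open>i\<close> is the largest amount by
      which coordinate \<open>i\<close> can grow. The minimum is attained at some \<open>C\<close>,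
      which becomes tight and also shows \<open>c \<in> G\<close>.\<close>
    define c where "c = Min ((\<lambda>A. f A - vec_sum z A) ` {A. i \<in> A})"
    have "c \<in> (\<lambda>A. f A - vec_sum z A) ` {A. i \<in> A}"
      unfolding c_def by (rule Min_in) auto
    then obtain C where C: "i \<in> C" "c = f C - vec_sum z C" by auto
    have c_le: "c \<le> f A - vec_sum z A" if "i \<in> A" for A
      unfolding c_def using that by (intro Min_le) auto
    have c0: "c \<ge> 0" using C z(1)[of C] by simp
    have cG: "c \<in> G" using C fG sumG[OF z(3)] Gd by simp
    define z' where "z' = z + axis i c"
    have le: "vec_sum z' A \<le> f A" for A
      using z(1)[of A] c_le[of A] by (auto simp: z'_def vec_sum_add_axis)
    have tC: "vec_sum z' C = f C"
      using C by (simp add: z'_def vec_sum_add_axis)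
    \<comment> \<open>If \<open>i \<in> T\<close>, the zero slack of \<open>T\<close> forces
      \<open>c = 0\<close>; otherwise the sum over \<open>T\<close> does not change.\<close>
    have tT: "vec_sum z' T = f T"
      using T(2) c0 c_le[of T] by (auto simp: z'_def vec_sum_add_axis)
    have "y $ j \<le> z' $ j" for j
      using z(2)[of j] c0 by (auto simp: z'_def axis_def)
    moreover have "z' $ j \<in> G" for j
      using z(3) cG by (simp add: z'_def axis_def Ga)
    moreover have "vec_sum z' (C \<union> T) = f (C \<union> T)"
      by (rule submodular_tight_Un[OF sub le tC tT])
    moreover have "insert i I \<subseteq> C \<union> T" using C T by auto
    ultimately show ?case using le by blast
  qed
  from this[of UNIV] obtain z where "\<forall>A. vec_sum z A \<le> f A" "\<forall>i. y $ i \<le> z $ i"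
    "\<forall>i. z $ i \<in> G" "vec_sum z UNIV = f UNIV"
    by (auto simp: top.extremum_unique)
  then show ?thesis using that by (auto simp: base_polyhedron_def)
qed

section \<open>Base polyhedra inside the bisubmodular polyhedron, weak supermajorization\<close>

lemma bisubmodularD:
  assumes "bisubmodular h" "S1 \<inter> T1 = {}" "S2 \<inter> T2 = {}"
  shows "h ((S1 \<union> S2) - (T1 \<union> T2), (T1 \<union> T2) - (S1 \<union> S2)) + h (S1 \<inter> S2, T1 \<inter> T2)
    \<le> h (S1, T1) + h (S2, T2)"
  using assms by (fastforce simp: bisubmodular_def disjoint_pairs_def)

lemma base_polyhedron_subset_bisub_polyhedron:
  fixes h :: "'n::finite set \<times> 'n set \<Rightarrow> real"
  assumes "bisubmodular h"
  shows "base_polyhedron (orthant_fun h (UNIV, {})) \<subseteq> bisub_polyhedron h"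
proof
  fix x assume x: "x \<in> base_polyhedron (orthant_fun h (UNIV, {}))"
  have "vec_sum x S - vec_sum x T \<le> h (S, T)" if "S \<inter> T = {}" for S T
  proof -
    \<comment> \<open>Joining \<open>(S, T)\<close> with \<open>(UNIV, {})\<close> cancels
      \<open>T\<close> and leaves \<open>(- T, {})\<close>; their meet is \<open>(S, {})\<close>.
      Only values with empty second argument remain to be bounded below by sums of
      \<open>x\<close>.\<close>
    have "h (- T, {}) + h (S, {}) \<le> h (S, T) + h (UNIV, {})"
      using bisubmodularD[OF assms that, of UNIV "{}"] by (simp add: Compl_eq_Diff_UNIV)
    moreover have "vec_sum x (- T) \<le> h (- T, {})" "vec_sum x S \<le> h (S, {})"
        "vec_sum x UNIV = h (UNIV, {})"
      using x by (auto simp: base_polyhedron_def orthant_fun_def)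
    moreover have "vec_sum x T + vec_sum x (- T) = vec_sum x UNIV"
      using vec_sum_Un_Int[of x T "- T"] by (simp add: vec_sum_def)
    ultimately show ?thesis by linarith
  qed
  then show "x \<in> bisub_polyhedron h"
    by (auto simp: bisub_polyhedron_def disjoint_pairs_def)
qed

lemma phi_le_antimono:
  assumes "antimono \<phi>" "\<And>i. a $ i > 0" "\<And>i. y $ i \<le> z $ i"
  shows "phi_le a b \<phi> z y"
  unfolding phi_le_def
proof (rule sum_mono)
  fix i
  have "(y $ i + b $ i) / a $ i \<le> (z $ i + b $ i) / a $ i"
    using assms(2,3)[of i] by (simp add: divide_right_mono)
  then show "a $ i * \<phi> ((z $ i + b $ i) / a $ i) \<le> a $ i * \<phi> ((y $ i + b $ i) / a $ i)"
    using assms(1) assms(2)[of i] by (simp add: antimonoD mult_left_mono)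
qed

lemma least_majorized_imp_least_supermajorized:
  fixes h :: "'n::finite set \<times> 'n set \<Rightarrow> real" and a b :: "real ^ 'n"
  assumes h: "bisubmodular h" and a: "\<And>i. a $ i > 0"
    and G0: "0 \<in> G" and Gd: "\<And>u v. u \<in> G \<Longrightarrow> v \<in> G \<Longrightarrow> u - v \<in> G"
    and hG: "\<And>p. p \<in> disjoint_pairs \<Longrightarrow> h p \<in> G"
    and x: "least_element (majorized a b)
        (base_polyhedron (orthant_fun h (UNIV, {})) \<inter> {x. \<forall>i. x $ i \<in> G}) x"
  shows "least_element (weakly_supermajorized a b)
        (bisub_polyhedron h \<inter> {x. \<forall>i. x $ i \<in> G}) x"
proof -
  let ?f = "orthant_fun h (UNIV, {})"
  have "weakly_supermajorized a b x y" if y: "y \<in> bisub_polyhedron h" "\<And>i. y $ i \<in> G" for y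
  proof -
    \<comment> \<open>With empty second components nothing cancels, so bisubmodularity becomes
      submodularity.\<close>
    have "?f (A \<union> B) + ?f (A \<inter> B) \<le> ?f A + ?f B" for A B
      using bisubmodularD[OF h, of A "{}" B "{}"] by (simp add: orthant_fun_def)
    moreover have "?f {} = 0"
      using h by (simp add: orthant_fun_def bisubmodular_def)
    moreover have "vec_sum y A \<le> ?f A" for A
    proof -
      have "vec_sum y A - vec_sum y {} \<le> h (A, {})"
        using y(1) unfolding bisub_polyhedron_def disjoint_pairs_def by blast
      then show ?thesis by (simp add: vec_sum_def orthant_fun_def)
    qed
    moreover have "?f A \<in> G" for A
      using hG by (simp add: orthant_fun_def disjoint_pairs_def)
    ultimately obtain z where z: "z \<in> base_polyhedron ?f" "\<And>i. y $ i \<le> z $ i" "\<And>i. z $ i \<in> G"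
      using raise_into_base_polyhedron[of ?f y G] G0 Gd y(2) by metis
    have "majorized a b x z"
      using x z by (simp add: least_element_def)
    moreover have "phi_le a b \<phi> z y" if "antimono \<phi>" for \<phi>
      using phi_le_antimono that a z(2) by blast
    ultimately show ?thesis
      unfolding majorized_def weakly_supermajorized_def phi_le_def by (meson order_trans)
  qed
  then show ?thesis
    using x base_polyhedron_subset_bisub_polyhedron[OF h]
    by (auto simp: least_element_def)
qed

section \<open>Reflection of vectors and weak submajorization\<close>

lemma bisubmodular_swap:
  assumes "bisubmodular h"
  shows "bisubmodular (h \<circ> prod.swap)"
  unfolding bisubmodular_def
proof (intro conjI)
  show "(h \<circ> prod.swap) ({}, {}) = 0"
    using assms by (simp add: bisubmodular_def)
qed (use bisubmodularD[OF assms] in \<open>auto simp: disjoint_pairs_def Int_commute\<close>)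

lemma bisub_polyhedron_swap:
  "- x \<in> bisub_polyhedron (h \<circ> prod.swap) \<longleftrightarrow> x \<in> bisub_polyhedron h"
proof -
  have "- x \<in> bisub_polyhedron (h \<circ> prod.swap) \<longleftrightarrow>
      (\<forall>S T. S \<inter> T = {} \<longrightarrow> vec_sum x T - vec_sum x S \<le> h (T, S))"
    by (auto simp: bisub_polyhedron_def disjoint_pairs_def vec_sum_uminus)
  also have "\<dots> \<longleftrightarrow> x \<in> bisub_polyhedron h"
    by (auto simp: bisub_polyhedron_def disjoint_pairs_def Int_commute)
  finally show ?thesis .
qed

text \<open>Negation turns the upper bounds \<open>h ({}, A)\<close> on sums into the lower bounds
  \<open>- h ({}, A)\<close>, so the reflection of a submodular base polyhedron is a supermodular
  one.\<close>

lemma base_polyhedron_swap: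
  "- x \<in> base_polyhedron (orthant_fun (h \<circ> prod.swap) (UNIV, {})) \<longleftrightarrow>
    x \<in> base_polyhedron_sup (\<lambda>X. - orthant_fun h ({}, UNIV) X)"
  by (auto simp: base_polyhedron_def base_polyhedron_sup_def orthant_fun_def vec_sum_uminus
      minus_le_iff minus_equation_iff)

text \<open>The shift \<open>b\<close> changes sign together with the vectors, so each argument of
  \<open>\<phi>\<close> is exactly negated.\<close>

lemma phi_le_uminus: "phi_le a (- b) \<phi> (- x) (- y) \<longleftrightarrow> phi_le a b (\<lambda>t. \<phi> (- t)) x y"
proof -
  have "(- u - v) / w = - ((u + v) / w)" for u v w :: real
    by (simp add: divide_simps)
  then show ?thesis by (simp add: phi_le_def)
qed

lemma convex_on_comp_uminus:
  fixes \<phi> :: "real \<Rightarrow> real"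
  assumes "convex_on UNIV \<phi>"
  shows "convex_on UNIV (\<lambda>t. \<phi> (- t))"
proof (rule convex_onI)
  fix t x y :: real
  assume "0 < t" "t < 1"
  then show "\<phi> (- ((1 - t) *\<^sub>R x + t *\<^sub>R y)) \<le> (1 - t) * \<phi> (- x) + t * \<phi> (- y)"
    using convex_onD[OF assms, of t "- x" "- y"] by simp
qed auto

lemma continuous_on_comp_uminus:
  fixes \<phi> :: "real \<Rightarrow> real"
  assumes "continuous_on UNIV \<phi>"
  shows "continuous_on UNIV (\<lambda>t. \<phi> (- t))"
  using assms by (rule continuous_on_compose2) (auto intro: continuous_intros)

lemma majorized_uminus:
  assumes "majorized a b x y"
  shows "majorized a (- b) (- x) (- y)"
  using assms
  by (simp add: majorized_def phi_le_uminus vec_sum_uminus convex_on_comp_uminus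
      continuous_on_comp_uminus)

text \<open>A non-decreasing \<open>\<phi>\<close> is tested through its mirror image, which is
  non-increasing and still convex and continuous; reflecting twice recovers
  \<open>\<phi>\<close>.\<close>

lemma weakly_supermajorized_uminusD:
  assumes "weakly_supermajorized a (- b) (- x) (- y)"
  shows "weakly_submajorized a b x y"
  unfolding weakly_submajorized_def
proof (intro allI impI)
  fix \<phi> :: "real \<Rightarrow> real"
  assume \<phi>: "mono \<phi> \<and> continuous_on UNIV \<phi> \<and> convex_on UNIV \<phi>"
  then have "antimono (\<lambda>t. \<phi> (- t))" by (auto simp: monotone_def)
  with \<phi> have "phi_le a (- b) (\<lambda>t. \<phi> (- t)) (- x) (- y)"
    using assms convex_on_comp_uminus continuous_on_comp_uminus
    unfolding weakly_supermajorized_def by blast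
  then show "phi_le a b \<phi> x y" by (simp add: phi_le_uminus)
qed

lemma least_majorized_imp_least_submajorized:
  fixes h :: "'n::finite set \<times> 'n set \<Rightarrow> real" and a b :: "real ^ 'n"
  assumes h: "bisubmodular h" and a: "\<And>i. a $ i > 0"
    and G0: "0 \<in> G" and Gd: "\<And>u v. u \<in> G \<Longrightarrow> v \<in> G \<Longrightarrow> u - v \<in> G"
    and hG: "\<And>p. p \<in> disjoint_pairs \<Longrightarrow> h p \<in> G"
    and x: "least_element (majorized a b)
        (base_polyhedron_sup (\<lambda>X. - orthant_fun h ({}, UNIV) X) \<inter> {x. \<forall>i. x $ i \<in> G}) x"
  shows "least_element (weakly_submajorized a b)
        (bisub_polyhedron h \<inter> {x. \<forall>i. x $ i \<in> G}) x"
proof -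
  let ?h = "h \<circ> prod.swap" and ?L = "{x :: real ^ 'n. \<forall>i. x $ i \<in> G}"
  let ?B = "base_polyhedron_sup (\<lambda>X. - orthant_fun h ({}, UNIV) X)"
  \<comment> \<open>A subgroup is closed under negation, so reflection preserves the admissible
    coordinates.\<close>
  have L: "- y \<in> ?L \<longleftrightarrow> y \<in> ?L" for y
    using Gd[OF G0] by (auto, metis minus_minus diff_0)
  have hG': "?h p \<in> G" if "p \<in> disjoint_pairs" for p
    using that hG by (cases p) (auto simp: disjoint_pairs_def Int_commute)
  have "majorized a (- b) (- x) y" if "y \<in> base_polyhedron (orthant_fun ?h (UNIV, {})) \<inter> ?L" for y
  proof -
    have "- y \<in> ?B \<inter> ?L"
      using that base_polyhedron_swap[of "- y" h] L[of y] by simp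
    then have "majorized a b x (- y)"
      using x by (simp add: least_element_def)
    then show ?thesis
      using majorized_uminus by fastforce
  qed
  moreover have "- x \<in> base_polyhedron (orthant_fun ?h (UNIV, {})) \<inter> ?L"
    using x L[of x] base_polyhedron_swap[of x h] by (simp add: least_element_def)
  ultimately have "least_element (majorized a (- b))
      (base_polyhedron (orthant_fun ?h (UNIV, {})) \<inter> ?L) (- x)"
    by (simp add: least_element_def)
  from least_majorized_imp_least_supermajorized[OF bisubmodular_swap[OF h] a G0 Gd hG' this]
  have *: "least_element (weakly_supermajorized a (- b)) (bisub_polyhedron ?h \<inter> ?L) (- x)" .
  have "weakly_submajorized a b x y" if "y \<in> bisub_polyhedron h \<inter> ?L" for y
  proof -
    have "- y \<in> bisub_polyhedron ?h \<inter> ?L"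
      using that bisub_polyhedron_swap[of y h] L[of y] by simp
    with * show ?thesis
      by (intro weakly_supermajorized_uminusD) (simp add: least_element_def)
  qed
  moreover have "x \<in> bisub_polyhedron h \<inter> ?L"
    using * bisub_polyhedron_swap[of x h] L[of x] by (simp add: least_element_def)
  ultimately show ?thesis by (simp add: least_element_def)
qed

theorem lemma11:
  fixes h :: "'n::finite set \<times> 'n set \<Rightarrow> real" and a b :: "real ^ 'n"
  assumes "bisubmodular h" and "\<forall>i. a $ i > 0"
  shows
    "(\<forall>x. least_element (majorized a b) (base_polyhedron (orthant_fun h (UNIV, {}))) x \<longrightarrow>
          least_element (weakly_supermajorized a b) (bisub_polyhedron h) x) \<and>
     (\<forall>x. least_element (majorized a b) (base_polyhedron_sup (\<lambda>X. - orthant_fun h ({}, UNIV) X)) x \<longrightarrow>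
          least_element (weakly_submajorized a b) (bisub_polyhedron h) x) \<and>
     ((\<forall>p\<in>disjoint_pairs. h p \<in> \<int>) \<and> b \<in> integral_vectors \<longrightarrow>
       (\<forall>x. least_element (majorized 1 b)
              (base_polyhedron (orthant_fun h (UNIV, {})) \<inter> integral_vectors) x \<longrightarrow>
            least_element (weakly_supermajorized 1 b) (bisub_polyhedron h \<inter> integral_vectors) x) \<and>
       (\<forall>x. least_element (majorized 1 b)
              (base_polyhedron_sup (\<lambda>X. - orthant_fun h ({}, UNIV) X) \<inter> integral_vectors) x \<longrightarrow>
            least_element (weakly_submajorized 1 b) (bisub_polyhedron h \<inter> integral_vectors) x))"
  \<comment> \<open>\<open>G = UNIV\<close> makes the coordinate restriction vacuous and yields the
    real statements; \<open>G = \<int>\<close> with \<open>a = 1\<close> yields the integral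
    ones.\<close>
  using assms least_majorized_imp_least_supermajorized[where G = UNIV and h = h and a = a and b = b]
    least_majorized_imp_least_submajorized[where G = UNIV and h = h and a = a and b = b]
    least_majorized_imp_least_supermajorized[where G = \<int> and h = h and a = 1 and b = b]
    least_majorized_imp_least_submajorized[where G = \<int> and h = h and a = 1 and b = b]
  by (simp add: integral_vectors_def)

end
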